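(* Let $(\sigma,V)$ be a c.b.c. representation of $E$ on $\mathcal H$ which is concave modulo $N(\widetilde V)$. Then the Cauchy dual $(\sigma,V')$ is hyponormal modulo $N(\widetilde V)$, that is, $\|(I_E\otimes\widetilde V'^* )\eta\|\le\|\widetilde V'\eta\|$ for every $\eta\in N(\widetilde V)^\perp$.
   Context: Setting: $E$ is a $C^*$-correspondence over a $C^*$-algebra $\mathcal B$, i.e. a Hilbert $C^*$-module over $\mathcal B$ with a left action given by a non-zero nondegenerate $*$-homomorphism $\phi:\mathcal B\to\mathcal L(E)$; $\mathcal H$ is a Hilbert space. A completely bounded covariant (c.b.c.) representation of $E$ on $\mathcal H$ is a pair $(\sigma,V)$ with $\sigma:\mathcal B\to B(\mathcal H)$ a nondegenerate representation and $V:E\to B(\mathcal H)$ a completely bounded linear map with $V(b\xi c)=\sigma(b)V(\xi)\sigma(c)$. It corresponds bijectively to the bounded operator $\widetilde V:E\otimes_\sigma\mathcal H\to\mathcal H$, $\widetilde V(\xi\otimes h)=V(\xi)h$, satisfying $\sigma(b)\widetilde V=\widetilde V(\phi(b)\otimes I_{\mathcal H})$. We write $E\otimes\mathcal H$ for $E\otimes_\sigma\mathcal H$; $E^{\otimes n}$ is the $n$-fold interior tensor power. $\widetilde V_2=\widetilde V(I_E\otimes\widetilde V):E^{\otimes 2}\otimes\mathcal H\to\mathcal H$. $R(\cdot)$, $N(\cdot)$ denote range and kernel. $(\sigma,V)$ is concave modulo $N(\widetilde V)$ if $\|\widetilde V_2\zeta\|^2+\|\zeta\|^2\le2\|(I_E\otimes\widetilde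 V)\zeta\|^2$ for all $\zeta\in N(I_E\otimes\widetilde V)^\perp$; in the paper it is shown that then $R(\widetilde V)$ is closed. When $R(\widetilde V)$ is closed, the Cauchy dual of $(\sigma,V)$ is the c.b.c. representation $(\sigma,V')$ associated with $\widetilde V'=\widetilde V(\widetilde V^*\widetilde V)^\dagger$, where $\dagger$ denotes the Moore–Penrose inverse; one has $N(\widetilde V')=N(\widetilde V)$. A c.b.c. representation $(\sigma,V)$ is hyponormal modulo $N(\widetilde V)$ if $\|(I_E\otimes\widetilde V^* )\eta\|\le\|\widetilde V\eta\|$ for every $\eta\in N(\widetilde V)^\perp$.
   Formalization: The range of Ṽ is assumed closed, as the Cauchy dual requires: concavity modulo N(Ṽ) does not imply it for general E (if E⊗E = 0, every c.b.c. representation is concave modulo N(Ṽ), even with non-closed range), and then the Cauchy dual is undefined. *)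

theory Defs
  imports "HOL-Analysis.Analysis"
begin

section \<open>Complex Hilbert spaces and \<open>C\<^sup>*\<close>-algebras\<close>

class complex_normed_vector = real_normed_vector +
  fixes scaleC :: "complex \<Rightarrow> 'a \<Rightarrow> 'a" (infixr "*\<^sub>C" 75)
  assumes scaleC_add_right: "c *\<^sub>C (x + y) = c *\<^sub>C x + c *\<^sub>C y"
    and scaleC_add_left: "(c + d) *\<^sub>C x = c *\<^sub>C x + d *\<^sub>C x"
    and scaleC_scaleC: "c *\<^sub>C (d *\<^sub>C x) = (c * d) *\<^sub>C x"
    and scaleR_scaleC: "r *\<^sub>R x = complex_of_real r *\<^sub>C x"
    and norm_scaleC: "norm (c *\<^sub>C x) = cmod c * norm x"

text \<open>Inner products, complex or algebra valued, are linear in the second argument.\<close>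

class chilbert_space = complex_normed_vector + banach +
  fixes cinner :: "'a \<Rightarrow> 'a \<Rightarrow> complex"
  assumes cinner_commute: "cinner x y = cnj (cinner y x)"
    and cinner_add_right: "cinner x (y + z) = cinner x y + cinner x z"
    and cinner_scaleC_right: "cinner x (c *\<^sub>C y) = c * cinner x y"
    and cinner_self: "cinner x x = complex_of_real ((norm x)\<^sup>2)"

text \<open>No unit is assumed.\<close>

class cstar_algebra = complex_normed_vector + banach + real_normed_algebra +
  fixes star :: "'a \<Rightarrow> 'a"
  assumes scaleC_mult_left: "(c *\<^sub>C a) * b = c *\<^sub>C (a * b)"
    and scaleC_mult_right: "a * (c *\<^sub>C b) = c *\<^sub>C (a * b)"
    and star_add: "star (a + b) = star a + star b"
    and star_scaleC: "star (c *\<^sub>C a) = cnj c *\<^sub>C star a"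
    and star_mult: "star (a * b) = star b * star a"
    and star_star: "star (star a) = a"
    and cstar_identity: "norm (star a * a) = (norm a)\<^sup>2"

definition cstar_positive :: "'b::cstar_algebra \<Rightarrow> bool" where
  "cstar_positive a \<longleftrightarrow> (\<exists>b. a = star b * b)"

definition clinear :: "('a::complex_normed_vector \<Rightarrow> 'c::complex_normed_vector) \<Rightarrow> bool" where
  "clinear T \<longleftrightarrow> (\<forall>x y. T (x + y) = T x + T y) \<and> (\<forall>c x. T (c *\<^sub>C x) = c *\<^sub>C T x)"

definition bounded_clinear ::
    "('a::complex_normed_vector \<Rightarrow> 'c::complex_normed_vector) \<Rightarrow> bool" where
  "bounded_clinear T \<longleftrightarrow> clinear T \<and> (\<exists>C. \<forall>x. norm (T x) \<le> C * norm x)"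

definition cadjoint ::
    "('h::chilbert_space \<Rightarrow> 'k::chilbert_space) \<Rightarrow> 'k \<Rightarrow> 'h" where
  "cadjoint T = (THE S. \<forall>x y. cinner (T x) y = cinner x (S y))"

definition null_space :: "('a \<Rightarrow> 'c::zero) \<Rightarrow> 'a set" where
  "null_space T = {x. T x = 0}"

definition orth_compl :: "'h::chilbert_space set \<Rightarrow> 'h set" where
  "orth_compl S = {x. \<forall>y\<in>S. cinner x y = 0}"

text \<open>\<open>G\<close> is the (bounded) Moore--Penrose inverse of \<open>M\<close>. It is unique, and it exists exactly
  when \<open>M\<close> has closed range.\<close>

definition is_moore_penrose_inverse ::
    "('h::chilbert_space \<Rightarrow> 'k::chilbert_space) \<Rightarrow> ('k \<Rightarrow> 'h) \<Rightarrow> bool" where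
  "is_moore_penrose_inverse M G \<longleftrightarrow> bounded_clinear G
     \<and> M \<circ> G \<circ> M = M \<and> G \<circ> M \<circ> G = G
     \<and> cadjoint (M \<circ> G) = M \<circ> G \<and> cadjoint (G \<circ> M) = G \<circ> M"

section \<open>\<open>C\<^sup>*\<close>-correspondences\<close>

text \<open>The norm carried by the type \<open>'e\<close> is the module norm, so completeness of the
  module is the \<open>banach\<close> sort constraint.\<close>

locale hilbert_module =
  fixes ract :: "'e::{complex_normed_vector,banach} \<Rightarrow> 'b::cstar_algebra \<Rightarrow> 'e"
    and ip :: "'e \<Rightarrow> 'e \<Rightarrow> 'b"
  assumes ract_clinear_left: "clinear (\<lambda>\<xi>. ract \<xi> b)"
    and ract_clinear_right: "clinear (\<lambda>b. ract \<xi> b)"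
    and ract_mult: "ract \<xi> (b * c) = ract (ract \<xi> b) c"
    and ip_clinear_right: "clinear (\<lambda>\<eta>. ip \<xi> \<eta>)"
    and ip_ract_right: "ip \<xi> (ract \<eta> b) = ip \<xi> \<eta> * b"
    and ip_star: "star (ip \<xi> \<eta>) = ip \<eta> \<xi>"
    and ip_positive: "cstar_positive (ip \<xi> \<xi>)"
    and norm_ip: "(norm \<xi>)\<^sup>2 = norm (ip \<xi> \<xi>)"

text \<open>\<open>lact b\<close> is the operator \<open>\<phi>(b)\<close>. Having the adjoint \<open>\<phi>(b\<^sup>*)\<close> makes it an element of
  \<open>L(E)\<close> (additivity, boundedness and right linearity follow) and makes \<open>\<phi>\<close>
  \<open>*\<close>-preserving. Here and below the closed linear span is written with the real span: the
  spanning sets are invariant under complex multiples.\<close>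

locale cstar_correspondence = hilbert_module ract ip
  for ract :: "'e::{complex_normed_vector,banach} \<Rightarrow> 'b::cstar_algebra \<Rightarrow> 'e"
    and ip :: "'e \<Rightarrow> 'e \<Rightarrow> 'b" +
  fixes lact :: "'b \<Rightarrow> 'e \<Rightarrow> 'e"
  assumes lact_clinear: "clinear (\<lambda>b. lact b \<xi>)"
    and lact_mult: "lact (a * b) \<xi> = lact a (lact b \<xi>)"
    and lact_adjoint: "ip (lact b \<xi>) \<eta> = ip \<xi> (lact (star b) \<eta>)"
    and lact_nonzero: "\<exists>b \<xi>. lact b \<xi> \<noteq> 0"
    and lact_nondegenerate: "closure (span (range (\<lambda>(b, \<xi>). lact b \<xi>))) = UNIV"

text \<open>The \<open>C\<^sup>*\<close>-norm of \<open>M\<^sub>n(B)\<close> is the norm of matrices acting by left multiplication on the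
  Hilbert module \<open>B\<^sup>n\<close>; the operator space structure of \<open>E\<close> is
  \<open>\<parallel>\<Xi>\<parallel>\<^sup>2 = \<parallel>\<Xi>\<^sup>*\<Xi>\<parallel>\<close> with \<open>(\<Xi>\<^sup>*\<Xi>)\<^sub>i\<^sub>j = \<Sum>\<^sub>k \<langle>\<Xi>\<^sub>k\<^sub>i, \<Xi>\<^sub>k\<^sub>j\<rangle>\<close>, i.e. the one
  inherited from the linking algebra. Matrices are functions on \<open>nat \<times> nat\<close> of which only
  the entries below \<open>n\<close> are used.\<close>

definition column_norm :: "nat \<Rightarrow> (nat \<Rightarrow> 'b::cstar_algebra) \<Rightarrow> real" where
  "column_norm n x = sqrt (norm (\<Sum>i<n. star (x i) * x i))"

definition matrix_norm :: "nat \<Rightarrow> (nat \<Rightarrow> nat \<Rightarrow> 'b::cstar_algebra) \<Rightarrow> real" where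
  "matrix_norm n A =
     Sup {column_norm n (\<lambda>i. \<Sum>j<n. A i j * x j) | x. column_norm n x \<le> 1}"

definition module_matrix_norm ::
    "('e \<Rightarrow> 'e \<Rightarrow> 'b::cstar_algebra) \<Rightarrow> nat \<Rightarrow> (nat \<Rightarrow> nat \<Rightarrow> 'e) \<Rightarrow> real" where
  "module_matrix_norm ip n X = sqrt (matrix_norm n (\<lambda>i j. \<Sum>k<n. ip (X k i) (X k j)))"

definition completely_bounded ::
    "('e \<Rightarrow> 'e \<Rightarrow> 'b::cstar_algebra) \<Rightarrow> ('e \<Rightarrow> 'h::chilbert_space \<Rightarrow> 'h) \<Rightarrow> bool" where
  "completely_bounded ip V \<longleftrightarrow> (\<exists>C. \<forall>n X h.
     sqrt (\<Sum>i<n. (norm (\<Sum>j<n. V (X i j) (h j)))\<^sup>2)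
       \<le> C * module_matrix_norm ip n X * sqrt (\<Sum>j<n. (norm (h j))\<^sup>2))"

section \<open>Covariant representations\<close>

locale nondegenerate_representation =
  fixes \<sigma> :: "'b::cstar_algebra \<Rightarrow> 'h::chilbert_space \<Rightarrow> 'h"
  assumes rep_bounded: "bounded_clinear (\<sigma> b)"
    and rep_clinear: "clinear (\<lambda>b. \<sigma> b h)"
    and rep_mult: "\<sigma> (a * b) h = \<sigma> a (\<sigma> b h)"
    and rep_star: "cinner (\<sigma> b h) k = cinner h (\<sigma> (star b) k)"
    and rep_nondegenerate: "closure (span (range (\<lambda>(b, h). \<sigma> b h))) = UNIV"

locale cbc_representation =
  cstar_correspondence ract ip lact + nondegenerate_representation \<sigma>
  for ract :: "'e::{complex_normed_vector,banach} \<Rightarrow> 'b::cstar_algebra \<Rightarrow> 'e"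
    and ip :: "'e \<Rightarrow> 'e \<Rightarrow> 'b"
    and lact :: "'b \<Rightarrow> 'e \<Rightarrow> 'e"
    and \<sigma> :: "'b \<Rightarrow> 'h::chilbert_space \<Rightarrow> 'h" +
  fixes V :: "'e \<Rightarrow> 'h \<Rightarrow> 'h"
  assumes V_bounded: "bounded_clinear (V \<xi>)"
    and V_clinear: "clinear (\<lambda>\<xi>. V \<xi> h)"
    and V_completely_bounded: "completely_bounded ip V"
    and V_covariant: "V (lact b (ract \<xi> c)) h = \<sigma> b (V \<xi> (\<sigma> c h))"

text \<open>The interior tensor product \<open>E \<otimes>\<^sub>\<sigma> H\<close> is the Hausdorff completion of the algebraic tensor
  product with respect to \<open>\<langle>\<xi> \<otimes> h, \<eta> \<otimes> k\<rangle> = \<langle>h, \<sigma>(\<langle>\<xi>, \<eta>\<rangle>) k\<rangle>\<close>. Since it depends on \<open>\<sigma>\<close>, it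
  cannot be a type constructor; instead \<open>is_interior_tensor ip \<sigma> t\<close> says that the Hilbert
  space \<open>'k\<close>, with \<open>t \<xi> h\<close> in the role of \<open>\<xi> \<otimes> h\<close>, is this completion. Such a
  \<open>t\<close> is unique up to a unique unitary.\<close>

definition is_interior_tensor ::
    "('e::complex_normed_vector \<Rightarrow> 'e \<Rightarrow> 'b::cstar_algebra) \<Rightarrow>
     ('b \<Rightarrow> 'h::chilbert_space \<Rightarrow> 'h) \<Rightarrow> ('e \<Rightarrow> 'h \<Rightarrow> 'k::chilbert_space) \<Rightarrow> bool" where
  "is_interior_tensor ip \<sigma> t \<longleftrightarrow>
     (\<forall>h. clinear (\<lambda>\<xi>. t \<xi> h)) \<and> (\<forall>\<xi>. clinear (t \<xi>))
     \<and> (\<forall>\<xi> h \<eta> k. cinner (t \<xi> h) (t \<eta> k) = cinner h (\<sigma> (ip \<xi> \<eta>) k))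
     \<and> closure (span (range (\<lambda>(\<xi>, h). t \<xi> h))) = UNIV"

text \<open>The representation \<open>b \<mapsto> \<phi>(b) \<otimes> I\<^sub>H\<close> of the algebra on \<open>E \<otimes>\<^sub>\<sigma> H\<close>.\<close>

definition induced_action ::
    "('b \<Rightarrow> 'e \<Rightarrow> 'e) \<Rightarrow> ('e \<Rightarrow> 'h \<Rightarrow> 'k::chilbert_space) \<Rightarrow> 'b \<Rightarrow> 'k \<Rightarrow> 'k" where
  "induced_action lact t b =
     (THE X. bounded_clinear X \<and> (\<forall>\<xi> h. X (t \<xi> h) = t (lact b \<xi>) h))"

text \<open>\<open>I\<^sub>E \<otimes> T\<close> from the tensor product with simple tensors \<open>t\<close> to the one with simple
  tensors \<open>t'\<close>.\<close>

definition ampliation ::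
    "('e \<Rightarrow> 'h \<Rightarrow> 'k::chilbert_space) \<Rightarrow> ('e \<Rightarrow> 'g \<Rightarrow> 'l::chilbert_space) \<Rightarrow>
     ('h \<Rightarrow> 'g) \<Rightarrow> 'k \<Rightarrow> 'l" where
  "ampliation t t' T =
     (THE X. bounded_clinear X \<and> (\<forall>\<xi> h. X (t \<xi> h) = t' \<xi> (T h)))"

text \<open>\<open>W\<close> is the bounded operator \<open>V\<close>-tilde on \<open>E \<otimes>\<^sub>\<sigma> H\<close>, with \<open>W (\<xi> \<otimes> h) = V(\<xi>) h\<close>.\<close>

definition is_associated_operator ::
    "('e \<Rightarrow> 'h::chilbert_space \<Rightarrow> 'k::chilbert_space) \<Rightarrow> ('e \<Rightarrow> 'h \<Rightarrow> 'h) \<Rightarrow> ('k \<Rightarrow> 'h) \<Rightarrow> bool" where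
  "is_associated_operator t V W \<longleftrightarrow> bounded_clinear W \<and> (\<forall>\<xi> h. W (t \<xi> h) = V \<xi> h)"

text \<open>From here on \<open>t\<close> gives the simple tensors of \<open>E \<otimes> H\<close>, and \<open>tt\<close> those of
  \<open>E \<otimes> (E \<otimes> H)\<close>, which is \<open>E\<^sup>\<otimes>\<^sup>2 \<otimes> H\<close> under the usual identification; \<open>W\<close> is the
  operator associated with the representation in question.\<close>

definition concave_mod_kernel ::
    "('e \<Rightarrow> 'h::chilbert_space \<Rightarrow> 'k::chilbert_space) \<Rightarrow> ('e \<Rightarrow> 'k \<Rightarrow> 'l::chilbert_space) \<Rightarrow>
     ('k \<Rightarrow> 'h) \<Rightarrow> bool" where
  "concave_mod_kernel t tt W \<longleftrightarrow> (\<forall>\<zeta>\<in>orth_compl (null_space (ampliation tt t W)).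
     (norm ((W \<circ> ampliation tt t W) \<zeta>))\<^sup>2 + (norm \<zeta>)\<^sup>2 \<le> 2 * (norm (ampliation tt t W \<zeta>))\<^sup>2)"

definition hyponormal_mod_kernel ::
    "('e \<Rightarrow> 'h::chilbert_space \<Rightarrow> 'k::chilbert_space) \<Rightarrow> ('e \<Rightarrow> 'k \<Rightarrow> 'l::chilbert_space) \<Rightarrow>
     ('k \<Rightarrow> 'h) \<Rightarrow> bool" where
  "hyponormal_mod_kernel t tt W \<longleftrightarrow> (\<forall>\<eta>\<in>orth_compl (null_space W).
     norm (ampliation t tt (cadjoint W) \<eta>) \<le> norm (W \<eta>))"

text \<open>\<open>V'\<close>, with associated operator \<open>W'\<close>, is the Cauchy dual of the representation with
  associated operator \<open>W\<close>. The dual is only defined when \<open>W\<close> has closed range.\<close>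

definition is_cauchy_dual ::
    "('e \<Rightarrow> 'h::chilbert_space \<Rightarrow> 'k::chilbert_space) \<Rightarrow> ('k \<Rightarrow> 'h) \<Rightarrow>
     ('e \<Rightarrow> 'h \<Rightarrow> 'h) \<Rightarrow> ('k \<Rightarrow> 'h) \<Rightarrow> bool" where
  "is_cauchy_dual t W V' W' \<longleftrightarrow> closed (range W)
     \<and> (\<exists>G. is_moore_penrose_inverse (cadjoint W \<circ> W) G \<and> W' = W \<circ> G)
     \<and> is_associated_operator t V' W'"

end

theory Submission
  imports Defs
begin

text \<open>Write \<open>W\<close> for \<open>V\<close>-tilde, \<open>G\<close> for the Moore--Penrose inverse of \<open>M = W\<^sup>*W\<close> and
  \<open>W' = W G\<close> for the operator of the Cauchy dual. Then \<open>S = W'\<^sup>* = G W\<^sup>*\<close> is the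
  Moore--Penrose inverse of \<open>W\<close>, and consequently \<open>U = I \<otimes> S\<close> is that of \<open>A = I \<otimes> W\<close>. Let
  \<open>\<eta>\<close> be orthogonal to the kernel of \<open>W\<close> and put \<open>q = A U \<eta>\<close>, the projection of \<open>\<eta>\<close> onto the
  range of \<open>A\<close>. As \<open>U \<eta>\<close> is orthogonal to the kernel of \<open>A\<close>, concavity gives
  \<open>\<parallel>U \<eta>\<parallel>\<^sup>2 \<le> 2 \<parallel>q\<parallel>\<^sup>2 - \<parallel>W q\<parallel>\<^sup>2\<close>. On the other hand
  \<open>\<langle>W q, W' \<eta>\<rangle> = \<langle>q, M G \<eta>\<rangle> = \<langle>q, \<eta>\<rangle> = \<parallel>q\<parallel>\<^sup>2\<close>, because \<open>M G\<close> is the projection onto the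
  orthogonal complement of the kernel of \<open>W\<close>. Hence
  \<open>0 \<le> \<parallel>W q - W' \<eta>\<parallel>\<^sup>2 = \<parallel>W q\<parallel>\<^sup>2 - 2 \<parallel>q\<parallel>\<^sup>2 + \<parallel>W' \<eta>\<parallel>\<^sup>2\<close>, and the two inequalities add up to
  \<open>\<parallel>U \<eta>\<parallel> \<le> \<parallel>W' \<eta>\<parallel>\<close>.

  The computation is short; most of the work goes into the operators it speaks of. The adjoint
  of a bounded operator, the action \<open>\<phi>(b) \<otimes> I\<close> and the operators \<open>I \<otimes> T\<close> are defined by
  descriptions, and have to be shown to exist. Adjoints come from the Riesz representation
  theorem (\<open>riesz_representation\<close>). The other two are prescribed on simple tensors and exist
  when they are bounded on finite sums of these (\<open>bounded_clinear_extension\<close>). The usual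
  argument for boundedness writes \<open>\<parallel>a\<parallel> - a\<close>, for \<open>a = b\<^sup>*b\<close> or \<open>a = T\<^sup>*T\<close>, as the square of a
  self-adjoint element commuting with everything that commutes with \<open>a\<close>. In place of a
  functional calculus, a multiple of \<open>a\<close> is written as \<open>2 c - c\<^sup>2\<close>, with \<open>c\<close> found by Banach's
  fixed-point theorem (\<open>quadratic_root\<close>).

  The operator \<open>I \<otimes> T\<close> is well defined when \<open>T\<close> intertwines the actions of the algebra. For
  \<open>W\<close> this follows from covariance (\<open>associated_operator_intertwines\<close>), and the property passes
  to adjoints and to the Moore--Penrose inverse \<open>G\<close> (\<open>intertwines_G\<close>), hence to \<open>S\<close>.\<close>

section \<open>Bounded operators and adjoints on complex Hilbert spaces\<close>

lemma bounded_clinear_scaleC: "bounded_clinear T \<Longrightarrow> T (c *\<^sub>C x) = c *\<^sub>C T x"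
  by (auto simp: bounded_clinear_def clinear_def)

lemma clinear_imp_linear: "clinear T \<Longrightarrow> linear T"
  by (rule linearI) (auto simp: clinear_def scaleR_scaleC)

lemma bounded_clinear_imp_bounded_linear:
  assumes "bounded_clinear T" shows "bounded_linear T"
proof -
  obtain C where "\<And>x. norm (T x) \<le> C * norm x"
    using assms by (auto simp: bounded_clinear_def)
  with assms show ?thesis
    by (intro bounded_linear_intro[where K = C])
       (auto simp: bounded_clinear_def clinear_def scaleR_scaleC mult.commute)
qed

lemma bounded_clinear_zero: "bounded_clinear T \<Longrightarrow> T 0 = 0"
  using linear_0[OF bounded_linear.linear] bounded_clinear_imp_bounded_linear by blast

lemma bounded_clinearI:
  assumes "bounded_linear T" and "\<And>c x. T (c *\<^sub>C x) = c *\<^sub>C T x"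
  shows "bounded_clinear T"
proof -
  obtain K where "\<And>x. norm (T x) \<le> norm x * K"
    using bounded_linear.bounded[OF assms(1)] by blast
  then show ?thesis using assms(2) linear_add[OF bounded_linear.linear[OF assms(1)]]
    by (auto simp: bounded_clinear_def clinear_def mult.commute)
qed

lemma bounded_clinear_compose:
  assumes "bounded_clinear S" and "bounded_clinear T"
  shows "bounded_clinear (S \<circ> T)"
  by (rule bounded_clinearI)
     (use assms in \<open>auto simp: comp_def bounded_clinear_scaleC
        intro: bounded_linear_compose bounded_clinear_imp_bounded_linear\<close>)

lemma cinner_add_left: "cinner (x + y) z = cinner x z + cinner (y::'h::chilbert_space) z"
proof -
  have "cinner (x + y) z = cnj (cinner z (x + y))"
    by (rule cinner_commute)
  also have "\<dots> = cinner x z + cinner y z"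
    by (simp add: cinner_add_right flip: cinner_commute)
  finally show ?thesis .
qed

lemma cinner_scaleC_left: "cinner (c *\<^sub>C x) y = cnj c * cinner (x::'h::chilbert_space) y"
proof -
  have "cinner (c *\<^sub>C x) y = cnj (cinner y (c *\<^sub>C x))"
    by (rule cinner_commute)
  also have "\<dots> = cnj c * cinner x y"
    by (simp add: cinner_scaleC_right flip: cinner_commute)
  finally show ?thesis .
qed

lemma Re_cinner_commute: "Re (cinner y x) = Re (cinner x (y::'h::chilbert_space))"
  by (subst cinner_commute) simp

lemma norm_add_squared:
  "(norm (x + y))\<^sup>2 = (norm x)\<^sup>2 + 2 * Re (cinner x y) + (norm (y::'h::chilbert_space))\<^sup>2"
proof -
  have n: "Re (cinner z z) = (norm z)\<^sup>2" for z :: 'h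
    by (simp add: cinner_self)
  show ?thesis
    unfolding n[symmetric] by (simp add: cinner_add_left cinner_add_right Re_cinner_commute[of y x])
qed

lemma Re_cinner_le_norm: "Re (cinner x y) \<le> norm x * norm (y::'h::chilbert_space)"
proof -
  have "(norm (x + y))\<^sup>2 \<le> (norm x + norm y)\<^sup>2"
    by (intro power_mono norm_triangle_ineq) auto
  then show ?thesis by (simp add: norm_add_squared power2_sum)
qed

lemma norm_cinner_le: "cmod (cinner x y) \<le> norm x * norm (y::'h::chilbert_space)"
proof -
  define u where "u = cnj (sgn (cinner x y))"
  have "complex_of_real (cmod (cinner x y)) = u * cinner x y"
    by (cases "cinner x y = 0")
       (auto simp: u_def sgn_eq complex_norm_square[symmetric] mult.commute[of _ "cinner x y"]
         power2_eq_square simp del: of_real_power)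
  then have "cmod (cinner x y) = Re (cinner x (u *\<^sub>C y))"
    by (metis Re_complex_of_real cinner_scaleC_right)
  also have "\<dots> \<le> norm x * norm (u *\<^sub>C y)"
    by (rule Re_cinner_le_norm)
  also have "\<dots> \<le> norm x * norm y"
    by (auto simp: norm_scaleC u_def norm_sgn)
  finally show ?thesis .
qed

interpretation cinner: bounded_bilinear "cinner :: 'h::chilbert_space \<Rightarrow> 'h \<Rightarrow> complex"
proof
  show "\<exists>K. \<forall>a b::'h. cmod (cinner a b) \<le> norm a * norm b * K"
    using norm_cinner_le by (intro exI[of _ 1]) auto
qed (auto simp: cinner_add_left cinner_add_right scaleR_scaleC cinner_scaleC_left
       cinner_scaleC_right scaleR_conv_of_real)

lemma norm_diff_squared:
  "(norm (x - y))\<^sup>2 = (norm x)\<^sup>2 - 2 * Re (cinner x y) + (norm (y::'h::chilbert_space))\<^sup>2"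
  using norm_add_squared[of x "-y"] by (simp add: cinner.minus_right)

lemma cinner_eqI:
  assumes "\<And>x. cinner x a = cinner x (b::'h::chilbert_space)" shows "a = b"
proof -
  have "cinner (a - b) (a - b) = 0" using assms by (simp add: cinner.diff_right)
  then show ?thesis by (simp add: cinner_self)
qed

lemma bounded_linear_eq_on_dense:
  fixes f g :: "'a::real_normed_vector \<Rightarrow> 'c::real_normed_vector"
  assumes "bounded_linear f" and "bounded_linear g" and "closure (span S) = UNIV"
    and "\<And>x. x \<in> S \<Longrightarrow> f x = g x"
  shows "f x = g x"
proof -
  have "span S \<subseteq> {x. f x = g x}"
    using linear_eq_on_span[of f g S] assms(1,2,4) by (blast dest: bounded_linear.linear)
  moreover have "closed {x. f x = g x}"
    using assms(1,2) by (intro closed_Collect_eq linear_continuous_on) auto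
  ultimately show ?thesis using assms(3) closure_minimal by blast
qed

text \<open>Operators on a tensor product are prescribed on simple tensors, whose span is dense; this
  transports adjointness from there.\<close>

lemma adjoint_pair_on_dense:
  fixes X :: "'h::chilbert_space \<Rightarrow> 'k::chilbert_space" and Y :: "'k \<Rightarrow> 'h"
  assumes "bounded_linear X" and "bounded_linear Y"
    and "closure (span S) = UNIV" and "closure (span S') = UNIV"
    and "\<And>x y. x \<in> S \<Longrightarrow> y \<in> S' \<Longrightarrow> cinner (X x) y = cinner x (Y y)"
  shows "cinner (X x) y = cinner x (Y y)"
proof -
  have "cinner (X x) y = cinner x (Y y)" if "x \<in> S" for x y
    using bounded_linear_eq_on_dense[OF cinner.bounded_linear_right
        bounded_linear_compose[OF cinner.bounded_linear_right assms(2)] assms(4), of "X x" x y]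
      assms(5)[OF that] by blast
  then show ?thesis
    using bounded_linear_eq_on_dense[OF bounded_linear_compose[OF cinner.bounded_linear_left assms(1)]
        cinner.bounded_linear_left assms(3), of y "Y y" x] by blast
qed

text \<open>The functional \<open>J(x) = \<parallel>x\<parallel>\<^sup>2 - 2 f(x)\<close> is bounded below and, by the
  parallelogram law, uniformly convex, so every minimising sequence converges; at the minimum
  the derivative of \<open>J\<close> vanishes in all directions, which is the asserted identity.\<close>

lemma riesz_representation:
  fixes f :: "'h::chilbert_space \<Rightarrow> real"
  assumes "bounded_linear f"
  shows "\<exists>z. \<forall>x. Re (cinner z x) = f x"
proof -
  interpret f: bounded_linear f by fact
  obtain K where K: "\<And>x. norm (f x) \<le> norm x * K" using f.bounded by blast
  define J where "J = (\<lambda>x. (norm x)\<^sup>2 - 2 * f x)"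
  define m where "m = Inf (range J)"
  have "- K\<^sup>2 \<le> J x" for x
  proof -
    have "0 \<le> (norm x - K)\<^sup>2" by simp
    then show ?thesis using K[of x] by (simp add: J_def power2_diff)
  qed
  then have bdd: "bdd_below (range J)" by (intro bdd_belowI) auto
  then have m_le: "m \<le> J x" for x by (auto simp: m_def intro: cInf_lower)
  have "\<exists>x. J x < m + inverse (Suc n)" for n
    using cInf_lessD[of "range J" "m + inverse (Suc n)"] by (auto simp: m_def)
  then obtain X where X: "\<And>n. J (X n) < m + inverse (Suc n)" by metis
  \<comment> \<open>Near-minimisers are close to each other, because their midpoint cannot go below \<open>m\<close>.\<close>
  have mid: "(norm (x - y))\<^sup>2 \<le> 2 * (J x - m) + 2 * (J y - m)" for x y
  proof -
    have half: "norm ((1/2) *\<^sub>R (x + y)) = norm (x + y) / 2" by simp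
    have "4 * J ((1/2) *\<^sub>R (x + y)) = (norm (x + y))\<^sup>2 - 4 * f x - 4 * f y"
      unfolding J_def half f.scaleR f.add by (simp add: power_divide field_simps)
    with m_le[of "(1/2) *\<^sub>R (x + y)"] show ?thesis
      by (simp add: J_def norm_add_squared norm_diff_squared)
  qed
  have "Cauchy X"
  proof (rule metric_CauchyI)
    fix e :: real assume "e > 0"
    define d where "d = e\<^sup>2 / 4"
    have "d > 0" using \<open>e > 0\<close> by (simp add: d_def)
    then obtain N where N: "inverse (real (Suc N)) < d" using reals_Archimedean by blast
    have "dist (X p) (X q) < e" if "p \<ge> N" "q \<ge> N" for p q
    proof -
      have "J (X n) - m < d" if "n \<ge> N" for n
      proof -
        have "J (X n) - m < inverse (real (Suc n))" using X[of n] by simp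
        also have "\<dots> \<le> inverse (real (Suc N))"
          using that by (auto intro!: le_imp_inverse_le)
        also note N
        finally show ?thesis .
      qed
      from this[OF that(1)] this[OF that(2)] have "(norm (X p - X q))\<^sup>2 < 4 * d"
        using mid[of "X p" "X q"] by argo
      then show ?thesis using \<open>e > 0\<close> by (simp add: d_def dist_norm power2_less_imp_less)
    qed
    then show "\<exists>M. \<forall>p\<ge>M. \<forall>q\<ge>M. dist (X p) (X q) < e" by blast
  qed
  then obtain z where z: "X \<longlonglongrightarrow> z" by (auto simp: Cauchy_convergent_iff convergent_def)
  have "(\<lambda>n. J (X n)) \<longlonglongrightarrow> J z"
    unfolding J_def by (intro tendsto_intros f.tendsto z)
  moreover have "(\<lambda>n. m + inverse (real (Suc n))) \<longlonglongrightarrow> m + 0"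
    by (intro tendsto_intros LIMSEQ_inverse_real_of_nat)
  ultimately have "J z \<le> m + 0"
    using X by (blast intro: LIMSEQ_le less_imp_le)
  then have Jz: "J z \<le> m" by simp
  have "Re (cinner z x) = f x" for x
  proof -
    define d where "d = Re (cinner z x) - f x"
    \<comment> \<open>A step of the perturbation \<open>z + s x\<close> that would lower \<open>J\<close> if \<open>d\<close> were nonzero.\<close>
    define s where "s = - d / ((norm x)\<^sup>2 + 1)"
    have pos: "(norm x)\<^sup>2 + 1 > 0" by (simp add: add_nonneg_pos)
    have "J z \<le> J (z + s *\<^sub>R x)" using Jz m_le order_trans by blast
    then have "0 \<le> 2 * s * d + s\<^sup>2 * (norm x)\<^sup>2"
      by (simp add: J_def norm_add_squared f.add f.scaleR cinner.scaleR_right d_def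
            power_mult_distrib algebra_simps)
    also have "\<dots> \<le> 2 * s * d + s\<^sup>2 * ((norm x)\<^sup>2 + 1)"
      by (simp add: mult_left_mono)
    also have "s\<^sup>2 * ((norm x)\<^sup>2 + 1) = - (s * d)"
      using pos by (simp add: s_def power2_eq_square)
    finally have "0 \<le> s * d" by (simp add: mult.commute)
    then have "d\<^sup>2 \<le> 0"
      using pos by (simp add: s_def power2_eq_square divide_le_0_iff)
    then show ?thesis by (simp add: d_def)
  qed
  then show ?thesis by blast
qed

lemma cadjoint_eqI:
  fixes T :: "'h::chilbert_space \<Rightarrow> 'k::chilbert_space"
  assumes "\<And>x y. cinner (T x) y = cinner x (S y)"
  shows "cadjoint T = S"
proof -
  have "S' = S" if "\<forall>x y. cinner (T x) y = cinner x (S' y)" for S'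
    by (rule ext, rule cinner_eqI) (use that assms in metis)
  then show ?thesis unfolding cadjoint_def using assms by (intro the_equality) blast+
qed

lemma cinner_cadjoint:
  fixes T :: "'h::chilbert_space \<Rightarrow> 'k::chilbert_space"
  assumes "bounded_clinear T"
  shows "cinner (T x) y = cinner x (cadjoint T y)"
proof -
  have "\<exists>z. \<forall>x. cinner (T x) y = cinner x z" for y
  proof -
    have "bounded_linear (\<lambda>x. Re (cinner (T x) y))"
      by (intro bounded_linear_compose[OF bounded_linear_Re] bounded_linear_compose[OF cinner.bounded_linear_left]
            bounded_clinear_imp_bounded_linear assms)
    then obtain z where z: "\<And>x. Re (cinner z x) = Re (cinner (T x) y)"
      using riesz_representation by blast
    then have re: "Re (cinner (T x) y) = Re (cinner x z)" for x
      using Re_cinner_commute[of z x] by simp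
    \<comment> \<open>The imaginary part of \<open>\<langle>x, z\<rangle>\<close> is the real part of \<open>\<langle>\<i>x, z\<rangle>\<close>.\<close>
    have "Im (cinner (T x) y) = Im (cinner x z)" for x
      using re[of "\<i> *\<^sub>C x"] by (simp add: bounded_clinear_scaleC[OF assms] cinner_scaleC_left)
    with re show ?thesis by (auto intro!: complex_eqI)
  qed
  then obtain S where "\<And>x y. cinner (T x) y = cinner x (S y)" by metis
  then show ?thesis using cadjoint_eqI[of T S] by simp
qed

lemma cinner_cadjoint_left:
  fixes T :: "'h::chilbert_space \<Rightarrow> 'k::chilbert_space"
  assumes "bounded_clinear T"
  shows "cinner (cadjoint T y) x = cinner y (T x)"
proof -
  have "cinner (cadjoint T y) x = cnj (cinner x (cadjoint T y))" by (rule cinner_commute)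
  also have "\<dots> = cnj (cinner (T x) y)" by (simp only: cinner_cadjoint[OF assms])
  also have "\<dots> = cinner y (T x)" by (rule cinner_commute[symmetric])
  finally show ?thesis .
qed

lemma bounded_clinear_cadjoint:
  fixes T :: "'h::chilbert_space \<Rightarrow> 'k::chilbert_space"
  assumes "bounded_clinear T"
  shows "bounded_clinear (cadjoint T)"
proof -
  note adj = cinner_cadjoint[OF assms, symmetric]
  obtain C where C: "C > 0" "\<And>x. norm (T x) \<le> C * norm x"
    using bounded_linear.pos_bounded[OF bounded_clinear_imp_bounded_linear[OF assms]]
    by (auto simp: mult.commute)
  have "norm (cadjoint T y) \<le> C * norm y" for y
  proof (cases "cadjoint T y = 0")
    case True
    then show ?thesis using C(1) by simp
  next
    case False
    have "(norm (cadjoint T y))\<^sup>2 = Re (cinner (T (cadjoint T y)) y)"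
      by (simp add: cinner_cadjoint[OF assms] cinner_self)
    also have "\<dots> \<le> C * norm (cadjoint T y) * norm y"
      by (rule order_trans[OF Re_cinner_le_norm]) (simp add: C(2) mult_right_mono)
    finally show ?thesis using False by (simp add: power2_eq_square)
  qed
  moreover have "cadjoint T (x + y) = cadjoint T x + cadjoint T y" for x y
    by (rule cinner_eqI) (simp add: cinner_add_right adj)
  moreover have "cadjoint T (c *\<^sub>C x) = c *\<^sub>C cadjoint T x" for c x
    by (rule cinner_eqI) (simp add: cinner_scaleC_right adj)
  ultimately show ?thesis by (auto simp: bounded_clinear_def clinear_def)
qed

section \<open>Extension from dense subspaces and square roots\<close>

lemma bounded_linear_scaleC: "bounded_linear (\<lambda>x::'a::complex_normed_vector. c *\<^sub>C x)"
  by (rule bounded_linear_intro[where K = "cmod c"])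
     (auto simp: scaleC_add_right scaleR_scaleC scaleC_scaleC norm_scaleC mult.commute)

text \<open>The extension is read off from its graph \<open>G\<close>, the closure of the span of the prescribed
  pairs \<open>(u i, v i)\<close>: the bound survives the closure and makes \<open>G\<close> single valued, and it makes
  the second components of a sequence in the span Cauchy as soon as the first ones are, so that
  \<open>G\<close> is defined everywhere. This avoids choosing representations of vectors as sums of
  simple tensors.\<close>

lemma bounded_clinear_extension:
  fixes u :: "'i \<Rightarrow> 'k::{complex_normed_vector,banach}" and v :: "'i \<Rightarrow> 'l::{complex_normed_vector,banach}"
  assumes dense: "closure (span (range u)) = UNIV"
    and bound: "\<And>S r. finite S \<Longrightarrow> norm (\<Sum>i\<in>S. r i *\<^sub>R v i) \<le> C * norm (\<Sum>i\<in>S. r i *\<^sub>R u i)"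
    and scale: "\<And>c i. \<exists>j. u j = c *\<^sub>C u i \<and> v j = c *\<^sub>C v i"
  shows "\<exists>X. bounded_clinear X \<and> (\<forall>i. X (u i) = v i)"
proof -
  define P where "P = span (range (\<lambda>i. (u i, v i)))"
  define G where "G = closure P"
  have P_bound: "norm (snd p) \<le> C * norm (fst p)" if "p \<in> P" for p
  proof -
    obtain A r where A: "finite A" "A \<subseteq> range (\<lambda>i. (u i, v i))" "p = (\<Sum>a\<in>A. r a *\<^sub>R a)"
      using \<open>p \<in> P\<close> unfolding P_def span_explicit by blast
    then obtain S where S: "inj_on (\<lambda>i. (u i, v i)) S" "A = (\<lambda>i. (u i, v i)) ` S"
      by (auto simp: subset_image_inj)
    with A(1) have "finite S" by (simp add: finite_image_iff)
    have "p = (\<Sum>i\<in>S. r (u i, v i) *\<^sub>R (u i, v i))"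
      using A(3) S by (simp add: sum.reindex)
    then have "fst p = (\<Sum>i\<in>S. r (u i, v i) *\<^sub>R u i)" "snd p = (\<Sum>i\<in>S. r (u i, v i) *\<^sub>R v i)"
      by (simp_all add: fst_sum snd_sum)
    then show ?thesis using bound[OF \<open>finite S\<close>, of "\<lambda>i. r (u i, v i)"] by simp
  qed
  have "closed {p::'k \<times> 'l. norm (snd p) \<le> C * norm (fst p)}"
    by (intro closed_Collect_le continuous_intros)
  then have G_bound: "norm (snd p) \<le> C * norm (fst p)" if "p \<in> G" for p
    using closure_minimal[of P "{p. norm (snd p) \<le> C * norm (fst p)}"] P_bound that
    unfolding G_def by blast
  have diff: "p - q \<in> G" if "p \<in> G" "q \<in> G" for p q
  proof -
    obtain a b where "\<forall>n. a n \<in> P" "a \<longlonglongrightarrow> p" "\<forall>n. b n \<in> P" "b \<longlonglongrightarrow> q"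
      using \<open>p \<in> G\<close> \<open>q \<in> G\<close> unfolding G_def closure_sequential by blast
    then have "(\<lambda>n. a n - b n) \<longlonglongrightarrow> p - q" "\<forall>n. a n - b n \<in> P"
      by (auto simp: P_def intro: tendsto_diff span_diff)
    then show ?thesis
      unfolding G_def closure_sequential by (intro exI[of _ "\<lambda>n. a n - b n"] conjI)
  qed
  have unique: "y = y'" if "(x, y) \<in> G" "(x, y') \<in> G" for x y y'
    using G_bound[OF diff[OF that]] by simp
  have scaled: "(c *\<^sub>C x, c *\<^sub>C y) \<in> G" if "(x, y) \<in> G" for c x y
  proof -
    define m where "m = (\<lambda>p::'k \<times> 'l. (c *\<^sub>C fst p, c *\<^sub>C snd p))"
    have m: "bounded_linear m"
      unfolding m_def
      by (intro bounded_linear_Pair bounded_linear_compose[OF bounded_linear_scaleC]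
            bounded_linear_fst bounded_linear_snd)
    have "m ` range (\<lambda>i. (u i, v i)) \<subseteq> range (\<lambda>i. (u i, v i))"
    proof clarsimp
      fix i
      obtain j where "u j = c *\<^sub>C u i" "v j = c *\<^sub>C v i" using scale by blast
      then show "m (u i, v i) \<in> range (\<lambda>i. (u i, v i))"
        by (auto simp: m_def intro!: rev_image_eqI[of j])
    qed
    then have "m ` P \<subseteq> P"
      unfolding P_def linear_span_image[OF bounded_linear.linear[OF m], symmetric]
      by (rule span_mono)
    then have "m ` P \<subseteq> G" using closure_subset by (auto simp: G_def)
    then have "m ` G \<subseteq> G"
      unfolding G_def by (intro image_closure_subset linear_continuous_on m) auto
    then show ?thesis using that by (force simp: m_def)
  qed
  have total: "\<exists>y. (x, y) \<in> G" for x
  proof -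
    have "x \<in> closure (span (range u))" using dense by simp
    also have "span (range u) = fst ` P"
      unfolding P_def by (simp add: linear_span_image[OF bounded_linear.linear[OF bounded_linear_fst], symmetric]
          image_image)
    finally obtain a where a: "\<forall>n. a n \<in> fst ` P" "a \<longlonglongrightarrow> x"
      unfolding closure_sequential by blast
    then have "\<forall>n. \<exists>y. (a n, y) \<in> P" by force
    then obtain b where b: "\<And>n. (a n, b n) \<in> P" by metis
    have "Cauchy b"
    proof (rule metric_CauchyI)
      fix e :: real assume "e > 0"
      have "e / (\<bar>C\<bar> + 1) > 0" using \<open>e > 0\<close> by simp
      then obtain M where M: "\<And>m n. m \<ge> M \<Longrightarrow> n \<ge> M \<Longrightarrow> dist (a m) (a n) < e / (\<bar>C\<bar> + 1)"
        using LIMSEQ_imp_Cauchy[OF a(2)] unfolding Cauchy_def by blast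
      have "dist (b m) (b n) < e" if "m \<ge> M" "n \<ge> M" for m n
      proof -
        have "(a m - a n, b m - b n) \<in> P"
          using span_diff[OF b[of m, unfolded P_def] b[of n, unfolded P_def]] by (simp add: P_def)
        then have "norm (b m - b n) \<le> C * norm (a m - a n)" using P_bound by force
        also have "\<dots> \<le> (\<bar>C\<bar> + 1) * norm (a m - a n)" by (intro mult_right_mono) auto
        also have "\<dots> < e" using M[OF that] by (simp add: dist_norm field_simps)
        finally show ?thesis by (simp add: dist_norm)
      qed
      then show "\<exists>M. \<forall>m\<ge>M. \<forall>n\<ge>M. dist (b m) (b n) < e" by blast
    qed
    then obtain y where "b \<longlonglongrightarrow> y" by (auto simp: Cauchy_convergent_iff convergent_def)
    then have "(\<lambda>n. (a n, b n)) \<longlonglongrightarrow> (x, y)" using a(2) by (rule tendsto_Pair[rotated])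
    then show ?thesis
      unfolding G_def closure_sequential using b by (intro exI[of _ y] exI[of _ "\<lambda>n. (a n, b n)"]) simp
  qed
  obtain X where X: "\<And>x. (x, X x) \<in> G" using total by metis
  have gen: "(u i, v i) \<in> G" for i
    unfolding G_def P_def by (intro subsetD[OF closure_subset] span_base) auto
  have neg: "(- x, - y) \<in> G" if "(x, y) \<in> G" for x y
    using diff[OF diff[OF that that] that] by simp
  have "X (x + y) = X x + X y" for x y
    using diff[OF X[of x] neg[OF X[of y]]] unique[OF X] by simp
  moreover have "X (c *\<^sub>C x) = c *\<^sub>C X x" for c x
    using unique[OF X scaled[OF X]] .
  moreover have "norm (X x) \<le> C * norm x" for x
    using G_bound[OF X] by simp
  ultimately have "bounded_clinear X" by (auto simp: bounded_clinear_def clinear_def)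
  then show ?thesis using unique[OF X gen] by blast
qed

text \<open>This replaces the square root of \<open>1 - a\<close>: the equation says \<open>1 - a = (1 - c)\<^sup>2\<close>, but it makes
  sense without a unit. The solution is the fixed point of \<open>c \<mapsto> (a + c\<^sup>2) / 2\<close>, a contraction of
  the ball of radius \<open>1/2\<close>. The set \<open>A\<close> carries additional properties to the solution, such as
  self-adjointness or commutation relations. The multiplication is a parameter because the lemma
  serves for a \<open>C\<^sup>*\<close>-algebra and for the operators on a Hilbert space.\<close>

lemma quadratic_root:
  fixes mul :: "'a::banach \<Rightarrow> 'a \<Rightarrow> 'a"
  assumes "bounded_bilinear mul" and norm_mul: "\<And>x y. norm (mul x y) \<le> norm x * norm y"
    and A: "closed A" "0 \<in> A" "\<And>c. c \<in> A \<Longrightarrow> (1/2) *\<^sub>R (a + mul c c) \<in> A"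
    and a: "norm a \<le> 3/4"
  shows "\<exists>c\<in>A. a = 2 *\<^sub>R c - mul c c"
proof -
  interpret mul: bounded_bilinear mul by fact
  define f where "f = (\<lambda>c. (1/2) *\<^sub>R (a + mul c c))"
  have "\<exists>!c. c \<in> A \<inter> cball 0 (1/2) \<and> f c = c"
  proof (rule Banach_fix[of _ "1/2"])
    show "complete (A \<inter> cball 0 (1/2))" using A(1) by (simp add: complete_eq_closed closed_Int)
    show "A \<inter> cball 0 (1/2) \<noteq> {}" using A(2) by force
    have "norm (f c) \<le> 1/2" if "norm c \<le> 1/2" for c
    proof -
      have "norm (mul c c) \<le> 1/2 * (1/2)"
        by (rule order_trans[OF norm_mul]) (intro mult_mono that; simp)
      then have "norm (a + mul c c) \<le> 1"
        using a norm_triangle_ineq[of a "mul c c"] by linarith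
      then show ?thesis by (simp add: f_def)
    qed
    then show "f ` (A \<inter> cball 0 (1/2)) \<subseteq> A \<inter> cball 0 (1/2)"
      using A(3) by (auto simp: f_def)
    show "dist (f c) (f d) \<le> 1/2 * dist c d" if "c \<in> A \<inter> cball 0 (1/2)" "d \<in> A \<inter> cball 0 (1/2)" for c d
    proof -
      have "f c - f d = (1/2) *\<^sub>R (mul c (c - d) + mul (c - d) d)"
        by (simp add: f_def mul.diff_left mul.diff_right flip: scaleR_diff_right)
      then have "dist (f c) (f d) = 1/2 * norm (mul c (c - d) + mul (c - d) d)"
        by (simp add: dist_norm)
      also have "\<dots> \<le> 1/2 * (norm c * norm (c - d) + norm (c - d) * norm d)"
        using norm_triangle_ineq[of "mul c (c - d)" "mul (c - d) d"] norm_mul[of c "c - d"]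
          norm_mul[of "c - d" d] by (intro mult_left_mono) auto
      also have "\<dots> = 1/2 * (norm c + norm d) * norm (c - d)" by (simp add: algebra_simps)
      also have "\<dots> \<le> 1/2 * 1 * norm (c - d)"
        using that by (intro mult_right_mono mult_left_mono) auto
      finally show ?thesis by (simp add: dist_norm)
    qed
  qed auto
  then obtain c where c: "c \<in> A" "f c = c" by blast
  then have "2 *\<^sub>R c = a + mul c c" by (metis f_def scaleR_half_double scaleR_2 scaleR_add_right)
  then show ?thesis using c(1) by (intro bexI[of _ c]) (auto simp: algebra_simps)
qed

text \<open>How a root \<open>c\<close> of \<open>s a = 2 c - c\<^sup>2\<close> gives a bound. Let \<open>y\<close>, \<open>y2\<close> and \<open>w\<close> stand for \<open>c x\<close>,
  \<open>c\<^sup>2 x\<close> and \<open>a x\<close>; then \<open>\<parallel>x\<parallel>\<^sup>2 - s \<langle>x, a x\<rangle> = \<parallel>x - c x\<parallel>\<^sup>2\<close> cannot be negative. Only these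
  vectors enter, so the lemma applies before \<open>c\<close> and \<open>a\<close> are known to act on the space of \<open>x\<close>.\<close>

lemma scaled_norm_le_of_root:
  fixes x y y2 w :: "'k::chilbert_space"
  assumes "cinner y y = cinner x y2" and "2 *\<^sub>R y - y2 = s *\<^sub>R w"
  shows "s * Re (cinner x w) \<le> (norm x)\<^sup>2"
proof -
  have "Re (cinner y y) = (norm y)\<^sup>2" by (simp add: cinner_self)
  moreover have "s * Re (cinner x w) = 2 * Re (cinner x y) - Re (cinner x y2)"
    using arg_cong[OF assms(2), of "\<lambda>z. Re (cinner x z)"]
    by (simp add: cinner.diff_right cinner.scaleR_right)
  ultimately have "(norm (x - y))\<^sup>2 = (norm x)\<^sup>2 - s * Re (cinner x w)"
    using assms(1) by (simp add: norm_diff_squared)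
  then show ?thesis by (smt (verit) zero_le_power2)
qed

section \<open>Interior tensor products and the induced action\<close>

lemma norm_star: "norm (star a) = norm (a::'b::cstar_algebra)"
proof -
  have le: "norm x \<le> norm (star x)" for x :: 'b
  proof (cases "x = 0")
    case False
    have "(norm x)\<^sup>2 \<le> norm (star x) * norm x"
      unfolding cstar_identity[symmetric] by (rule norm_mult_ineq)
    then show ?thesis using False by (simp add: power2_eq_square)
  qed simp
  show ?thesis using le[of a] le[of "star a"] by (simp add: star_star)
qed

lemma bounded_linear_star: "bounded_linear (star :: 'b::cstar_algebra \<Rightarrow> 'b)"
  by (rule bounded_linear_intro[where K = 1]) (auto simp: star_add star_scaleC scaleR_scaleC norm_star)

text \<open>The factor \<open>s\<close> makes \<open>b\<^sup>*b\<close> small enough for the fixed-point argument.\<close>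

lemma star_mult_self_root:
  fixes b :: "'b::cstar_algebra"
  obtains s c where "s > 0" and "star c = c" and "s *\<^sub>R (star b * b) = 2 *\<^sub>R c - c * c"
proof -
  interpret star: bounded_linear "star :: 'b \<Rightarrow> 'b" by (rule bounded_linear_star)
  define s where "s = (3/4) / (1 + norm (star b * b))"
  have "s > 0" by (simp add: s_def add_pos_nonneg)
  have "norm (s *\<^sub>R (star b * b)) \<le> 3/4"
    using \<open>s > 0\<close> by (simp add: s_def field_simps add_pos_nonneg)
  moreover have "closed {c::'b. star c = c}"
    by (intro closed_Collect_eq linear_continuous_on star.bounded_linear_axioms continuous_on_id)
  ultimately have "\<exists>c\<in>{c. star c = c}. s *\<^sub>R (star b * b) = 2 *\<^sub>R c - c * c"
    by (intro quadratic_root[OF bounded_bilinear_mult norm_mult_ineq])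
       (auto simp: star.zero star.scaleR star.add star_mult star_star)
  then show ?thesis using that \<open>s > 0\<close> by blast
qed

text \<open>What \<open>\<sigma>\<close> and the induced action on \<open>E \<otimes> H\<close> have in common: with either of them, the
  tensor product with \<open>E\<close> and the operators \<open>I \<otimes> T\<close> can be formed.\<close>

definition star_action :: "('b::cstar_algebra \<Rightarrow> 'h::chilbert_space \<Rightarrow> 'h) \<Rightarrow> bool" where
  "star_action \<pi> \<longleftrightarrow> (\<forall>b. bounded_clinear (\<pi> b)) \<and>
     (\<forall>b x y. cinner (\<pi> b x) y = cinner x (\<pi> (star b) y))"

lemma cinner_star_action: "star_action \<pi> \<Longrightarrow> cinner x (\<pi> b y) = cinner (\<pi> (star b) x) y"
  by (simp add: star_action_def star_star)

definition intertwines :: "('b \<Rightarrow> 'h \<Rightarrow> 'h) \<Rightarrow> ('b \<Rightarrow> 'g \<Rightarrow> 'g) \<Rightarrow> ('h \<Rightarrow> 'g) \<Rightarrow> bool" where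
  "intertwines \<pi> \<rho> T \<longleftrightarrow> (\<forall>b x. T (\<pi> b x) = \<rho> b (T x))"

lemma intertwines_cadjoint:
  assumes T: "bounded_clinear T" "intertwines \<pi> \<rho> T"
    and "star_action \<pi>" and "star_action \<rho>"
  shows "intertwines \<rho> \<pi> (cadjoint T)"
  unfolding intertwines_def
proof (intro allI cinner_eqI)
  fix b y x
  have "cinner x (cadjoint T (\<rho> b y)) = cinner (T (\<pi> (star b) x)) y"
    using T(2) by (simp add: intertwines_def cinner_star_action[OF assms(4)] flip: cinner_cadjoint[OF T(1)])
  also have "\<dots> = cinner x (\<pi> b (cadjoint T y))"
    by (simp add: cinner_cadjoint[OF T(1)] cinner_star_action[OF assms(3)])
  finally show "cinner x (cadjoint T (\<rho> b y)) = cinner x (\<pi> b (cadjoint T y))" .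
qed

locale interior_tensor =
  fixes ip :: "'e::{complex_normed_vector,banach} \<Rightarrow> 'e \<Rightarrow> 'b::cstar_algebra"
    and \<pi> :: "'b \<Rightarrow> 'h::chilbert_space \<Rightarrow> 'h"
    and t :: "'e \<Rightarrow> 'h \<Rightarrow> 'k::chilbert_space"
  assumes is_interior_tensor: "is_interior_tensor ip \<pi> t"
begin

abbreviation simple_tensors :: "'k set" where
  "simple_tensors \<equiv> range (\<lambda>(\<xi>, h). t \<xi> h)"

lemma dense: "closure (span simple_tensors) = UNIV"
  and cinner_simple: "cinner (t \<xi> h) (t \<eta> k) = cinner h (\<pi> (ip \<xi> \<eta>) k)"
  and linear_left: "linear (\<lambda>\<xi>. t \<xi> h)"
  and linear_right: "linear (t \<xi>)"
  and scaleC_right: "t \<xi> (c *\<^sub>C h) = c *\<^sub>C t \<xi> h"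
  using is_interior_tensor by (auto simp: is_interior_tensor_def clinear_imp_linear clinear_def)

lemma cinner_sum_simple:
  "cinner (\<Sum>i\<in>S. t (p i) (h i)) (\<Sum>j\<in>S'. t (q j) (k j)) =
     (\<Sum>i\<in>S. \<Sum>j\<in>S'. cinner (h i) (\<pi> (ip (p i) (q j)) (k j)))"
  unfolding cinner.sum_left cinner.sum_right cinner_simple by (rule sum.swap)

text \<open>A map prescribed on simple tensors extends once it is bounded on their finite sums.
  Coefficients need no separate treatment, since they can be moved into the second factor.\<close>

lemma ex1_bounded_clinear:
  fixes v :: "'e \<Rightarrow> 'h \<Rightarrow> 'l::chilbert_space"
  assumes "s > 0" and lin: "\<And>\<xi>. clinear (v \<xi>)"
    and bound: "\<And>(S :: ('e \<times> 'h) set) p h. finite S \<Longrightarrow>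
      s * (norm (\<Sum>i\<in>S. v (p i) (h i)))\<^sup>2 \<le> (norm (\<Sum>i\<in>S. t (p i) (h i)))\<^sup>2"
  shows "\<exists>!X. bounded_clinear X \<and> (\<forall>\<xi> h. X (t \<xi> h) = v \<xi> h)"
proof -
  have ex: "\<exists>X. bounded_clinear X \<and> (\<forall>i. X ((\<lambda>(\<xi>, h). t \<xi> h) i) = (\<lambda>(\<xi>, h). v \<xi> h) i)"
  proof (rule bounded_clinear_extension[OF dense])
    fix S :: "('e \<times> 'h) set" and r assume "finite S"
    have eq: "(\<Sum>i\<in>S. r i *\<^sub>R (\<lambda>(\<xi>, h). f \<xi> h) i) = (\<Sum>i\<in>S. f (fst i) (r i *\<^sub>R snd i))"
      if "\<And>\<xi>. linear (f \<xi>)" for f :: "'e \<Rightarrow> 'h \<Rightarrow> 'x::chilbert_space"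
      by (intro sum.cong) (auto simp: linear_scale[OF that])
    have eq': "(\<Sum>i\<in>S. r i *\<^sub>R (\<lambda>(\<xi>, h). t \<xi> h) i) = (\<Sum>i\<in>S. t (fst i) (r i *\<^sub>R snd i))"
      by (intro sum.cong) (auto simp: linear_scale[OF linear_right])
    let ?z = "norm (\<Sum>i\<in>S. r i *\<^sub>R (\<lambda>(\<xi>, h). v \<xi> h) i)"
    let ?x = "norm (\<Sum>i\<in>S. r i *\<^sub>R (\<lambda>(\<xi>, h). t \<xi> h) i)"
    have "s * ?z\<^sup>2 \<le> ?x\<^sup>2"
      using bound[OF \<open>finite S\<close>, of fst "\<lambda>i. r i *\<^sub>R snd i"]
      unfolding eq[OF clinear_imp_linear[OF lin]] eq' .
    then have "?z\<^sup>2 \<le> (sqrt (1/s) * ?x)\<^sup>2"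
      using \<open>s > 0\<close> by (simp add: power_mult_distrib field_simps)
    then show "?z \<le> sqrt (1/s) * ?x"
      using \<open>s > 0\<close> by (intro power2_le_imp_le[of ?z]) auto
  next
    fix c :: complex and i :: "'e \<times> 'h"
    show "\<exists>j. (\<lambda>(\<xi>, h). t \<xi> h) j = c *\<^sub>C (\<lambda>(\<xi>, h). t \<xi> h) i \<and>
        (\<lambda>(\<xi>, h). v \<xi> h) j = c *\<^sub>C (\<lambda>(\<xi>, h). v \<xi> h) i"
      using lin by (intro exI[of _ "(fst i, c *\<^sub>C snd i)"])
        (auto simp: scaleC_right clinear_def split: prod.splits)
  qed
  have unique: "X = Y" if "bounded_clinear X" "\<forall>\<xi> h. X (t \<xi> h) = v \<xi> h"
      "bounded_clinear Y" "\<forall>\<xi> h. Y (t \<xi> h) = v \<xi> h" for X Y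
  proof
    show "X x = Y x" for x
      by (rule bounded_linear_eq_on_dense[OF bounded_clinear_imp_bounded_linear[OF that(1)]
            bounded_clinear_imp_bounded_linear[OF that(3)] dense]) (use that(2,4) in auto)
  qed
  from ex obtain X where "bounded_clinear X" "\<forall>\<xi> h. X (t \<xi> h) = v \<xi> h" by auto
  with unique show ?thesis by blast
qed

text \<open>Boundedness of \<open>\<phi>(b) \<otimes> I\<close> is the point, and it is a fact about the algebra: a root \<open>c\<close> of
  \<open>s b\<^sup>*b = 2 c - c\<^sup>2\<close> in the algebra acts on the left factor, and self-adjointness of \<open>c\<close> lets it
  pass from one side of the inner product to the other.\<close>

lemma induced_action_simple:
  assumes "cstar_correspondence ract ip lact"
  shows "bounded_clinear (induced_action lact t b)" (is ?bdd)
    and "induced_action lact t b (t \<xi> h) = t (lact b \<xi>) h" (is ?act)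
proof -
  interpret cstar_correspondence ract ip lact by fact
  obtain s c where s: "s > 0" and c: "star c = c" and root: "s *\<^sub>R (star b * b) = 2 *\<^sub>R c - c * c"
    by (rule star_mult_self_root)
  have root_lact: "2 *\<^sub>R lact c \<xi> - lact c (lact c \<xi>) = s *\<^sub>R lact (star b * b) \<xi>" for \<xi>
  proof -
    have lin: "linear (\<lambda>b. lact b \<xi>)" by (rule clinear_imp_linear[OF lact_clinear])
    show ?thesis
      using arg_cong[OF root, of "\<lambda>a. lact a \<xi>"]
      by (simp add: linear_diff[OF lin] linear_scale[OF lin] lact_mult[of c c])
  qed
  have "\<exists>!X. bounded_clinear X \<and> (\<forall>\<xi> h. X (t \<xi> h) = t (lact b \<xi>) h)"
  proof (rule ex1_bounded_clinear[OF s])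
    show "clinear (t (lact b \<xi>))" for \<xi>
      using is_interior_tensor by (simp add: is_interior_tensor_def)
    fix S :: "('e \<times> 'h) set" and p h
    define x where "x = (\<Sum>i\<in>S. t (p i) (h i))"
    define y where "y = (\<Sum>i\<in>S. t (lact c (p i)) (h i))"
    define y2 where "y2 = (\<Sum>i\<in>S. t (lact c (lact c (p i))) (h i))"
    define w where "w = (\<Sum>i\<in>S. t (lact (star b * b) (p i)) (h i))"
    define z where "z = (\<Sum>i\<in>S. t (lact b (p i)) (h i))"
    have "cinner y y = cinner x y2"
      unfolding x_def y_def y2_def cinner_sum_simple by (simp add: lact_adjoint c)
    moreover have "2 *\<^sub>R y - y2 = s *\<^sub>R w"
      unfolding y_def y2_def w_def scaleR_sum_right sum_subtractf[symmetric]
      by (simp add: linear_scale[OF linear_left, symmetric] linear_diff[OF linear_left, symmetric]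
          root_lact)
    ultimately have "s * Re (cinner x w) \<le> (norm x)\<^sup>2" by (rule scaled_norm_le_of_root)
    moreover have "cinner x w = cinner z z"
      unfolding x_def w_def z_def cinner_sum_simple by (simp add: lact_adjoint lact_mult)
    ultimately show "s * (norm z)\<^sup>2 \<le> (norm x)\<^sup>2" by (simp add: cinner_self)
  qed
  from theI'[OF this] show ?bdd ?act by (auto simp: induced_action_def)
qed

lemma star_action_induced_action:
  assumes "cstar_correspondence ract ip lact"
  shows "star_action (induced_action lact t)"
proof -
  interpret cstar_correspondence ract ip lact by fact
  note simple = induced_action_simple[OF assms]
  have "cinner (induced_action lact t b x) y = cinner x (induced_action lact t (star b) y)" for b x y
    by (rule adjoint_pair_on_dense[OF _ _ dense dense])
       (auto simp: simple cinner_simple lact_adjoint intro: bounded_clinear_imp_bounded_linear)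
  then show ?thesis by (auto simp: star_action_def simple)
qed

end

section \<open>Operators of the form \<open>I \<otimes> T\<close>\<close>

text \<open>The operator counterpart of the root of \<open>b\<^sup>*b\<close>. Since \<open>T\<^sup>*T\<close> commutes with the action and the
  self-adjoint operators commuting with it form a closed set preserved by the iteration, the root
  commutes with the action too.\<close>

lemma cadjoint_self_root:
  fixes T :: "'h::chilbert_space \<Rightarrow> 'g::chilbert_space"
  assumes T: "bounded_clinear T" "intertwines \<pi> \<rho> T" and \<pi>: "star_action \<pi>" and \<rho>: "star_action \<rho>"
  shows "\<exists>s c. s > 0 \<and> (\<forall>x y. cinner (c x) y = cinner x (c y)) \<and> intertwines \<pi> \<pi> c \<and>
    (\<forall>x. s *\<^sub>R cadjoint T (T x) = 2 *\<^sub>R c x - c (c x))"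
proof -
  have comm: "cadjoint T (T (\<pi> b x)) = \<pi> b (cadjoint T (T x))" for b x
    using T(2) intertwines_cadjoint[OF T \<pi> \<rho>] by (simp add: intertwines_def)
  have bl: "bounded_linear (\<lambda>x. cadjoint T (T x))"
    using bounded_clinear_compose[OF bounded_clinear_cadjoint[OF T(1)] T(1)]
    by (simp add: bounded_clinear_imp_bounded_linear comp_def)
  define D where "D = Blinfun (\<lambda>x. cadjoint T (T x))"
  have D: "blinfun_apply D x = cadjoint T (T x)" for x
    by (simp add: D_def bounded_linear_Blinfun_apply[OF bl])
  define s where "s = (3/4) / (1 + norm D)"
  have "s > 0" by (simp add: s_def add_pos_nonneg)
  define A where "A = {c :: 'h \<Rightarrow>\<^sub>L 'h. (\<forall>x y. cinner (c x) y = cinner x (c y)) \<and>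
     (\<forall>b x. c (\<pi> b x) = \<pi> b (c x))}"
  have \<pi>_lin: "bounded_linear (\<pi> b)" for b
    using \<pi> by (simp add: star_action_def bounded_clinear_imp_bounded_linear)
  have app: "bounded_linear (\<lambda>c. blinfun_apply c x)" for x :: 'h
    by (rule blinfun.bounded_linear_left)
  have "closed A"
    unfolding A_def
    by (intro closed_Collect_conj closed_Collect_all closed_Collect_eq linear_continuous_on
          bounded_linear_compose[OF \<pi>_lin app] bounded_linear_compose[OF cinner.bounded_linear_left app]
          bounded_linear_compose[OF cinner.bounded_linear_right app] app)
  moreover have "norm (s *\<^sub>R D) \<le> 3/4"
    using \<open>s > 0\<close> by (simp add: s_def field_simps add_pos_nonneg)
  moreover have "(1/2) *\<^sub>R (s *\<^sub>R D + (c o\<^sub>L c)) \<in> A" if "c \<in> A" for c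
  proof -
    have "cinner (cadjoint T (T x)) y = cinner x (cadjoint T (T y))" for x y
      by (simp add: cinner_cadjoint_left[OF T(1)] cinner_cadjoint[OF T(1)])
    then show ?thesis
      using that comm linear_scale[OF bounded_linear.linear[OF \<pi>_lin]] linear_add[OF bounded_linear.linear[OF \<pi>_lin]]
      by (simp add: A_def blinfun.scaleR_left blinfun.add_left D cinner.add_left cinner.add_right
            cinner.scaleR_left cinner.scaleR_right)
  qed
  moreover have "0 \<in> A"
    using linear_0[OF bounded_linear.linear[OF \<pi>_lin]] by (simp add: A_def cinner.zero_left cinner.zero_right)
  ultimately obtain c where "c \<in> A" and c: "s *\<^sub>R D = 2 *\<^sub>R c - (c o\<^sub>L c)"
    using quadratic_root[OF bounded_bilinear_blinfun_compose norm_blinfun_compose, of A "s *\<^sub>R D"] by blast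
  have "s *\<^sub>R cadjoint T (T x) = 2 *\<^sub>R c x - c (c x)" for x
    using arg_cong[OF c, of "\<lambda>f. blinfun_apply f x"]
    by (simp add: blinfun.scaleR_left blinfun.diff_left D)
  with \<open>c \<in> A\<close> \<open>s > 0\<close> show ?thesis
    by (intro exI[of _ s] exI[of _ "blinfun_apply c"]) (simp add: A_def intertwines_def)
qed

text \<open>Boundedness of \<open>I \<otimes> T\<close> is obtained as for \<open>\<phi>(b) \<otimes> I\<close>, with the root \<open>c\<close> of
  \<open>s T\<^sup>*T = 2 c - c\<^sup>2\<close> now acting on the right factor, where it passes through the inner
  product because it commutes with the action.\<close>

lemma ampliation_simple:
  fixes t :: "'e::{complex_normed_vector,banach} \<Rightarrow> 'h::chilbert_space \<Rightarrow> 'k::chilbert_space"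
    and t' :: "'e \<Rightarrow> 'g::chilbert_space \<Rightarrow> 'l::chilbert_space"
  assumes t: "is_interior_tensor ip \<pi> t" and t': "is_interior_tensor ip \<rho> t'"
    and \<pi>: "star_action \<pi>" and \<rho>: "star_action \<rho>"
    and T: "bounded_clinear T" "intertwines \<pi> \<rho> T"
  shows "bounded_clinear (ampliation t t' T)" (is ?bdd)
    and "ampliation t t' T (t \<xi> h) = t' \<xi> (T h)" (is ?simple)
proof -
  interpret t: interior_tensor ip \<pi> t by (rule interior_tensor.intro[OF t])
  interpret t': interior_tensor ip \<rho> t' by (rule interior_tensor.intro[OF t'])
  obtain s c where s: "s > 0" and c: "\<And>x y. cinner (c x) y = cinner x (c y)" "intertwines \<pi> \<pi> c"
    and root: "\<And>x. s *\<^sub>R cadjoint T (T x) = 2 *\<^sub>R c x - c (c x)"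
    using cadjoint_self_root[OF T \<pi> \<rho>] by blast
  have "\<exists>!X. bounded_clinear X \<and> (\<forall>\<xi> h. X (t \<xi> h) = t' \<xi> (T h))"
  proof (rule t.ex1_bounded_clinear[OF s])
    show "clinear (\<lambda>h. t' \<xi> (T h))" for \<xi>
      using T(1) t' by (simp add: clinear_def bounded_clinear_def is_interior_tensor_def)
    fix S :: "('e \<times> 'h) set" and p h
    define x where "x = (\<Sum>i\<in>S. t (p i) (h i))"
    define y where "y = (\<Sum>i\<in>S. t (p i) (c (h i)))"
    define y2 where "y2 = (\<Sum>i\<in>S. t (p i) (c (c (h i))))"
    define w where "w = (\<Sum>i\<in>S. t (p i) (cadjoint T (T (h i))))"
    define z where "z = (\<Sum>i\<in>S. t' (p i) (T (h i)))"
    have "cinner y y = cinner x y2"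
      unfolding x_def y_def y2_def t.cinner_sum_simple
      using c by (simp add: intertwines_def)
    moreover have "2 *\<^sub>R y - y2 = s *\<^sub>R w"
      unfolding y_def y2_def w_def scaleR_sum_right sum_subtractf[symmetric]
      by (simp add: linear_scale[OF t.linear_right, symmetric] linear_diff[OF t.linear_right, symmetric] root)
    ultimately have "s * Re (cinner x w) \<le> (norm x)\<^sup>2" by (rule scaled_norm_le_of_root)
    moreover have "cinner x w = cinner z z"
    proof -
      have "cinner h (\<pi> b (cadjoint T (T k))) = cinner (T h) (\<rho> b (T k))" for h k b
        using intertwines_cadjoint[OF T \<pi> \<rho>]
        by (simp add: intertwines_def cinner_cadjoint[OF T(1)])
      then show ?thesis
        unfolding x_def w_def z_def t.cinner_sum_simple t'.cinner_sum_simple by simp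
    qed
    ultimately show "s * (norm z)\<^sup>2 \<le> (norm x)\<^sup>2" by (simp add: cinner_self)
  qed
  from theI'[OF this] show ?bdd ?simple by (auto simp: ampliation_def)
qed

context interior_tensor
begin

lemma adjoint_pair_simple:
  assumes "bounded_clinear X" and "\<And>\<xi> h. X (t \<xi> h) = t \<xi> (T h)"
    and "intertwines \<pi> \<pi> T" and "\<And>x y. cinner (T x) y = cinner x (T y)"
  shows "cinner (X x) y = cinner x (X y)"
  by (rule adjoint_pair_on_dense[OF _ _ dense dense])
     (use assms in \<open>auto simp: cinner_simple intertwines_def intro: bounded_clinear_imp_bounded_linear\<close>)

end

text \<open>The covariance of \<open>V\<close> involves both actions of the algebra at once. Without a unit the
  right one cannot be set to \<open>1\<close>; instead \<open>\<xi>c \<otimes> h = \<xi> \<otimes> \<sigma>(c)h\<close> moves it to the vector, and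
  the vectors \<open>\<sigma>(c)h\<close> span a dense subspace.\<close>

lemma associated_operator_intertwines:
  assumes "cbc_representation ract ip lact \<sigma> V"
    and t: "is_interior_tensor ip \<sigma> t" and W: "is_associated_operator t V W"
  shows "intertwines (induced_action lact t) \<sigma> W"
proof -
  interpret cbc_representation ract ip lact \<sigma> V by fact
  interpret interior_tensor ip \<sigma> t by (rule interior_tensor.intro[OF t])
  have W_bdd: "bounded_clinear W" and W_simple: "W (t \<xi> h) = V \<xi> h" for \<xi> h
    using W by (auto simp: is_associated_operator_def)
  note act = induced_action_simple[OF cstar_correspondence_axioms]
  have ract_simple: "t (lact b (ract \<xi> c)) h = t (lact b \<xi>) (\<sigma> c h)" for b \<xi> c h
  proof -
    have "cinner x (t (lact b (ract \<xi> c)) h) = cinner x (t (lact b \<xi>) (\<sigma> c h))" for x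
    proof (rule bounded_linear_eq_on_dense[OF cinner.bounded_linear_left cinner.bounded_linear_left dense])
      fix x assume "x \<in> simple_tensors"
      then obtain \<eta> k where "x = t \<eta> k" by auto
      have "ip \<eta> (lact b \<zeta>) = ip (lact (star b) \<eta>) \<zeta>" for \<zeta>
        by (simp add: lact_adjoint star_star)
      then show "cinner x (t (lact b (ract \<xi> c)) h) = cinner x (t (lact b \<xi>) (\<sigma> c h))"
        unfolding \<open>x = t \<eta> k\<close> cinner_simple by (simp add: ip_ract_right rep_mult)
    qed
    then show ?thesis by (rule cinner_eqI)
  qed
  have V_left: "V (lact b \<xi>) h = \<sigma> b (V \<xi> h)" for b \<xi> h
  proof (rule bounded_linear_eq_on_dense[OF _ _ rep_nondegenerate,
          where f = "V (lact b \<xi>)" and g = "\<lambda>h. \<sigma> b (V \<xi> h)"])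
    fix h assume "h \<in> range (\<lambda>(b, h). \<sigma> b h)"
    then obtain c k where "h = \<sigma> c k" by auto
    then show "V (lact b \<xi>) h = \<sigma> b (V \<xi> h)"
      using V_covariant[of b \<xi> c k] ract_simple[of b \<xi> c k]
      by (simp flip: W_simple)
  qed (intro bounded_clinear_imp_bounded_linear V_bounded
        bounded_linear_compose[OF bounded_clinear_imp_bounded_linear[OF rep_bounded]])+
  have "W (induced_action lact t b x) = \<sigma> b (W x)" for b x
  proof (rule bounded_linear_eq_on_dense[OF _ _ dense,
        where f = "\<lambda>x. W (induced_action lact t b x)" and g = "\<lambda>x. \<sigma> b (W x)"])
    show "bounded_linear (\<lambda>x. W (induced_action lact t b x))" "bounded_linear (\<lambda>x. \<sigma> b (W x))"
      using W_bdd rep_bounded act(1)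
      by (blast intro: bounded_linear_compose bounded_clinear_imp_bounded_linear)+
  qed (auto simp: act W_simple V_left)
  then show ?thesis by (simp add: intertwines_def)
qed

section \<open>The Moore--Penrose inverse of a self-adjoint operator\<close>

locale selfadjoint_moore_penrose =
  fixes M G :: "'k::chilbert_space \<Rightarrow> 'k"
  assumes M_bounded: "bounded_clinear M"
    and M_selfadjoint: "cinner (M x) y = cinner x (M y)"
    and moore_penrose: "is_moore_penrose_inverse M G"
begin

lemma G_bounded: "bounded_clinear G"
  and MGM: "M (G (M x)) = M x"
  and GMG: "G (M (G x)) = G x"
  using moore_penrose by (auto simp: is_moore_penrose_inverse_def fun_eq_iff)

lemma MG_selfadjoint: "cinner (M (G x)) y = cinner x (M (G y))"
  and GM_selfadjoint: "cinner (G (M x)) y = cinner x (G (M y))"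
  using cinner_cadjoint[OF bounded_clinear_compose[OF M_bounded G_bounded], of x y]
    cinner_cadjoint[OF bounded_clinear_compose[OF G_bounded M_bounded], of x y] moore_penrose
  by (simp_all add: is_moore_penrose_inverse_def)

text \<open>Both products are self-adjoint. Taking the adjoints of \<open>M (G M) = M\<close> and \<open>(M G) M = M\<close>
  gives \<open>(G M) M = M = M (M G)\<close>, whence \<open>G M = G M M G = M G\<close>.\<close>

lemma GM_eq_MG: "G (M x) = M (G x)"
proof -
  have GMM: "G (M (M y)) = M y" for y
    by (rule cinner_eqI) (simp add: MGM flip: GM_selfadjoint M_selfadjoint)
  have MMG: "M (M (G y)) = M y" for y
    by (rule cinner_eqI) (metis MGM MG_selfadjoint M_selfadjoint)
  show ?thesis using GMM[of "G x"] MMG[of x] by simp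
qed

lemma G_selfadjoint: "cinner (G x) y = cinner x (G y)"
proof -
  have "cinner (G x) y = cinner (G (M (G x))) y" by (simp add: GMG)
  also have "\<dots> = cinner (M (G x)) (G y)"
    using GM_selfadjoint[of "G x" y] M_selfadjoint[of "G x" "G y"] by (simp add: GM_eq_MG)
  also have "\<dots> = cinner x (G (M (G y)))" by (simp add: MG_selfadjoint GM_eq_MG)
  finally show ?thesis by (simp add: GMG)
qed

text \<open>The projection \<open>P = G M = M G\<close> satisfies \<open>P b P = P b\<close>, as \<open>M\<close> commutes with \<open>b\<close>; the adjoint of
  this for \<open>b\<^sup>*\<close> is \<open>P b P = b P\<close>, so \<open>P\<close> commutes with the action. Then
  \<open>G b = G P b = G b M G = G M b G = P b G = b P G = b G\<close>.\<close>

lemma intertwines_G: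
  assumes \<pi>: "star_action \<pi>" and M: "intertwines \<pi> \<pi> M"
  shows "intertwines \<pi> \<pi> G"
proof -
  have M': "M (\<pi> b x) = \<pi> b (M x)" for b x using M by (simp add: intertwines_def)
  have compress: "G (M (\<pi> b (G (M x)))) = G (M (\<pi> b x))" for b x
    by (simp add: M' MGM)
  have commute: "\<pi> b (G (M x)) = G (M (\<pi> b x))" for b x
  proof (rule cinner_eqI)
    fix y
    have "cinner y (\<pi> b (G (M x))) = cinner (G (M (\<pi> (star b) y))) x"
      by (simp add: cinner_star_action[OF \<pi>] GM_selfadjoint)
    also have "\<dots> = cinner (G (M (\<pi> (star b) (G (M y))))) x" by (simp only: compress)
    also have "\<dots> = cinner y (G (M (\<pi> b (G (M x)))))"
      by (simp add: GM_selfadjoint flip: cinner_star_action[OF \<pi>])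
    finally show "cinner y (\<pi> b (G (M x))) = cinner y (G (M (\<pi> b x)))" by (simp only: compress)
  qed
  have "G (\<pi> b x) = \<pi> b (G x)" for b x
  proof -
    have "G (\<pi> b x) = G (\<pi> b (M (G x)))"
      using GMG[of "\<pi> b x"] commute[of b x] by (simp add: GM_eq_MG)
    also have "\<dots> = \<pi> b (G (M (G x)))" by (simp add: commute flip: M')
    finally show ?thesis by (simp add: GMG)
  qed
  then show ?thesis by (simp add: intertwines_def)
qed

end

section \<open>Hyponormality of the Cauchy dual\<close>

theorem theorem5p7:
  fixes ract :: "'e::{complex_normed_vector,banach} \<Rightarrow> 'b::cstar_algebra \<Rightarrow> 'e"
    and ip :: "'e \<Rightarrow> 'e \<Rightarrow> 'b"
    and lact :: "'b \<Rightarrow> 'e \<Rightarrow> 'e"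
    and \<sigma> :: "'b \<Rightarrow> 'h::chilbert_space \<Rightarrow> 'h"
    and V V' :: "'e \<Rightarrow> 'h \<Rightarrow> 'h"
    and t :: "'e \<Rightarrow> 'h \<Rightarrow> 'k::chilbert_space"
    and tt :: "'e \<Rightarrow> 'k \<Rightarrow> 'l::chilbert_space"
    and W W' :: "'k \<Rightarrow> 'h"
  assumes rep: "cbc_representation ract ip lact \<sigma> V"
    and tensor: "is_interior_tensor ip \<sigma> t"
    and tensor2: "is_interior_tensor ip (induced_action lact t) tt"
    and tilde: "is_associated_operator t V W"
    and concave: "concave_mod_kernel t tt W"
    and dual: "is_cauchy_dual t W V' W'"
  shows "hyponormal_mod_kernel t tt W' \<and>
    (\<forall>\<eta>\<in>orth_compl (null_space W).
       norm (ampliation t tt (cadjoint W') \<eta>) \<le> norm (W' \<eta>))"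
proof -
  interpret cbc_representation ract ip lact \<sigma> V by fact
  interpret t: interior_tensor ip \<sigma> t by (rule interior_tensor.intro[OF tensor])
  define \<pi> where "\<pi> = induced_action lact t"
  interpret tt: interior_tensor ip \<pi> tt
    unfolding \<pi>_def by (rule interior_tensor.intro[OF tensor2])
  have \<sigma>: "star_action \<sigma>" by (simp add: star_action_def rep_bounded rep_star)
  have \<pi>: "star_action \<pi>"
    unfolding \<pi>_def by (rule t.star_action_induced_action[OF cstar_correspondence_axioms])
  have W: "bounded_clinear W" using tilde by (simp add: is_associated_operator_def)
  have W_tw: "intertwines \<pi> \<sigma> W"
    unfolding \<pi>_def by (rule associated_operator_intertwines[OF rep tensor tilde])
  note Ws = bounded_clinear_cadjoint[OF W] and Ws_tw = intertwines_cadjoint[OF W W_tw \<pi> \<sigma>]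
  define M where "M = (\<lambda>x. cadjoint W (W x))"
  obtain G where G: "is_moore_penrose_inverse M G" and W': "W' = W \<circ> G"
    using dual by (auto simp: is_cauchy_dual_def M_def comp_def)
  interpret selfadjoint_moore_penrose M G
  proof
    show "bounded_clinear M"
      using bounded_clinear_compose[OF Ws W] by (simp add: M_def comp_def)
    show "cinner (M x) y = cinner x (M y)" for x y
      by (simp add: M_def cinner_cadjoint_left[OF W] cinner_cadjoint[OF W])
  qed (rule G)
  have G_tw: "intertwines \<pi> \<pi> G"
    using W_tw Ws_tw by (intro intertwines_G[OF \<pi>]) (simp add: M_def intertwines_def)
  define S where "S = (\<lambda>h. G (cadjoint W h))"
  \<comment> \<open>\<open>S\<close> is the Moore--Penrose inverse of \<open>W\<close>: the products \<open>S W\<close> and \<open>W S\<close> are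
    self-adjoint and \<open>S W S = S\<close>.\<close>
  have W'_adj: "cadjoint W' = S"
    by (rule cadjoint_eqI) (simp add: W' S_def cinner_cadjoint[OF W] G_selfadjoint)
  have S: "bounded_clinear S"
    using bounded_clinear_compose[OF G_bounded Ws] by (simp add: S_def comp_def)
  have S_tw: "intertwines \<sigma> \<pi> S" using G_tw Ws_tw by (simp add: intertwines_def S_def)
  have SW: "S (W x) = G (M x)" for x by (simp add: S_def M_def)
  have SWS: "S (W (S h)) = S h" for h
    using GMG[of "cadjoint W h"] by (simp add: S_def M_def)
  have WS_selfadjoint: "cinner (W (S h)) k = cinner h (W (S k))" for h k
    by (simp add: S_def cinner_cadjoint[OF W] G_selfadjoint cinner_cadjoint_left[OF W]
        flip: cinner_cadjoint_left[OF W])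

  define A where "A = ampliation tt t W"
  define U where "U = ampliation t tt S"
  note A = ampliation_simple[OF tt.is_interior_tensor tensor \<pi> \<sigma> W W_tw, folded A_def]
  note U = ampliation_simple[OF tensor tt.is_interior_tensor \<sigma> \<pi> S S_tw, folded U_def]
  \<comment> \<open>The same relations hold for \<open>A = I \<otimes> W\<close> and \<open>U = I \<otimes> S\<close>.\<close>
  have AU_selfadjoint: "cinner (A (U x)) y = cinner x (A (U y))" for x y
  proof (rule t.adjoint_pair_simple[where T = "\<lambda>h. W (S h)"])
    show "bounded_clinear (\<lambda>x. A (U x))"
      using bounded_clinear_compose[OF A(1) U(1)] by (simp add: comp_def)
    show "intertwines \<sigma> \<sigma> (\<lambda>h. W (S h))" using W_tw S_tw by (simp add: intertwines_def)
  qed (simp_all add: A U WS_selfadjoint)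
  have UA_selfadjoint: "cinner (U (A x)) y = cinner x (U (A y))" for x y
  proof (rule tt.adjoint_pair_simple[where T = "\<lambda>k. S (W k)"])
    show "bounded_clinear (\<lambda>x. U (A x))"
      using bounded_clinear_compose[OF U(1) A(1)] by (simp add: comp_def)
    show "intertwines \<pi> \<pi> (\<lambda>k. S (W k))" using W_tw S_tw by (simp add: intertwines_def)
  qed (simp_all add: A U SW GM_selfadjoint)
  have UAU: "U (A (U x)) = U x" for x
  proof (rule bounded_linear_eq_on_dense[OF _ _ t.dense, where f = "\<lambda>x. U (A (U x))" and g = U])
    show "bounded_linear U" using U(1) by (rule bounded_clinear_imp_bounded_linear)
    show "bounded_linear (\<lambda>x. U (A (U x)))"
      using bounded_clinear_compose[OF U(1) bounded_clinear_compose[OF A(1) U(1)]]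
      by (auto simp: comp_def dest: bounded_clinear_imp_bounded_linear)
  qed (auto simp: A U SWS)

  have bound: "norm (U \<eta>) \<le> norm (W' \<eta>)" if \<eta>: "\<eta> \<in> orth_compl (null_space W)" for \<eta>
  proof -
    \<comment> \<open>\<open>U \<eta>\<close> is in the range of the projection \<open>U A\<close>, whose kernel contains that of \<open>A\<close>; so the
      concavity hypothesis applies to it.\<close>
    have "U \<eta> \<in> orth_compl (null_space A)"
      unfolding orth_compl_def null_space_def
    proof clarsimp
      fix \<nu> assume "A \<nu> = 0"
      then have "cinner (U (A (U \<eta>))) \<nu> = 0"
        by (simp add: UA_selfadjoint bounded_clinear_zero[OF U(1)] cinner.zero_right)
      then show "cinner (U \<eta>) \<nu> = 0" by (simp only: UAU)
    qed
    then have ineq: "(norm (W (A (U \<eta>))))\<^sup>2 + (norm (U \<eta>))\<^sup>2 \<le> 2 * (norm (A (U \<eta>)))\<^sup>2"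
      using concave by (simp add: concave_mod_kernel_def A_def)
    \<comment> \<open>\<open>M G\<close> is the projection onto \<open>N(W)\<^sup>\<bottom>\<close>.\<close>
    have "M (G \<eta>) = \<eta>"
    proof -
      interpret M: bounded_linear M using M_bounded by (rule bounded_clinear_imp_bounded_linear)
      define \<delta> where "\<delta> = \<eta> - M (G \<eta>)"
      have "M \<delta> = 0" using MGM[of \<eta>] by (simp add: \<delta>_def M.diff GM_eq_MG)
      then have "cinner (W \<delta>) (W \<delta>) = 0"
        by (simp add: cinner_cadjoint[OF W] M_def cinner.zero_right)
      then have "\<delta> \<in> null_space W" by (simp add: null_space_def cinner_self)
      then have "cinner \<eta> \<delta> = 0" using \<eta> by (simp add: orth_compl_def)
      moreover have "cinner (M (G \<eta>)) \<delta> = 0"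
        using GM_eq_MG[of \<delta>]
        by (simp add: MG_selfadjoint \<open>M \<delta> = 0\<close> bounded_clinear_zero[OF G_bounded] cinner.zero_right)
      ultimately have "cinner \<delta> \<delta> = 0" by (subst \<delta>_def) (simp add: cinner.diff_left)
      then show ?thesis by (simp add: cinner_self \<delta>_def)
    qed
    then have "cinner (W (A (U \<eta>))) (W' \<eta>) = cinner (A (U \<eta>)) \<eta>"
      by (simp add: W' cinner_cadjoint[OF W] M_def)
    also have "\<dots> = cinner (A (U \<eta>)) (A (U \<eta>))"
      using AU_selfadjoint[of "A (U \<eta>)" \<eta>] by (simp add: UAU)
    finally have "(norm (W (A (U \<eta>)) - W' \<eta>))\<^sup>2 =
        (norm (W (A (U \<eta>))))\<^sup>2 - 2 * (norm (A (U \<eta>)))\<^sup>2 + (norm (W' \<eta>))\<^sup>2"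
      by (simp add: norm_diff_squared cinner_self)
    then have "(norm (U \<eta>))\<^sup>2 \<le> (norm (W' \<eta>))\<^sup>2"
      using ineq zero_le_power2[of "norm (W (A (U \<eta>)) - W' \<eta>)"] by linarith
    then show ?thesis by (rule power2_le_imp_le) simp
  qed
  have "null_space W \<subseteq> null_space W'"
  proof
    fix x assume "x \<in> null_space W"
    then have "M x = 0"
      by (simp add: null_space_def M_def bounded_clinear_zero[OF Ws])
    then have "G (M (G x)) = 0"
      by (simp add: bounded_clinear_zero[OF G_bounded] flip: GM_eq_MG)
    then show "x \<in> null_space W'"
      by (simp add: null_space_def W' GMG bounded_clinear_zero[OF W])
  qed
  then have "orth_compl (null_space W') \<subseteq> orth_compl (null_space W)"
    by (auto simp: orth_compl_def)
  with bound show ?thesis by (auto simp: hyponormal_mod_kernel_def W'_adj U_def)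
qed

end
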